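(* Let $G$ be a finite simple graph. If the complement $\overline{G}$ is triangle-free and $\operatorname{diam}(\overline{G})=3$, then $pc_{1,2}(G)\leq 3$.
   Context: All graphs are finite, undirected and simple. An edge-coloring is an arbitrary map from the edge set to a set of colors (adjacent edges may receive the same color). In an edge-colored graph, a path $P$ is a distance $2$-proper path if no two edges of $P$ of the same color appear with fewer than $2$ edges in between on $P$; equivalently, any two distinct edges of $P$ that are consecutive on $P$ or separated by exactly one edge of $P$ have different colors. The $(1,2)$-proper connection number $pc_{1,2}(G)$ is the minimum number of colors in an edge-coloring of $G$ such that every two distinct vertices of $G$ are joined by a distance $2$-proper path in $G$. The inequality $pc_{1,2}(G)\leq 3$ means that such a coloring with at most $3$ colors exists (in particular that $G$ is connected). The condition $\operatorname{diam}(\overline{G})=3$ includes that $\overline{G}$ is connected. *)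

theory Defs
  imports "HOL-Library.Extended_Nat"
begin

text \<open>A graph is given by its vertex set and its set of edges, an edge being a two-element set
  of vertices.\<close>

definition simple_graph :: "'a set \<Rightarrow> 'a set set \<Rightarrow> bool" where
  "simple_graph V E \<longleftrightarrow> finite V \<and> (\<forall>e\<in>E. e \<subseteq> V \<and> card e = 2)"

definition complement_edges :: "'a set \<Rightarrow> 'a set set \<Rightarrow> 'a set set" where
  "complement_edges V E = {e. e \<subseteq> V \<and> card e = 2 \<and> e \<notin> E}"

definition triangle_free :: "'a set set \<Rightarrow> bool" where
  "triangle_free E \<longleftrightarrow>
     (\<nexists>x y z. x \<noteq> y \<and> y \<noteq> z \<and> x \<noteq> z \<and> {x, y} \<in> E \<and> {y, z} \<in> E \<and> {x, z} \<in> E)"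

text \<open>A path is the list of its vertices; its length is the number of its edges.\<close>

definition path_edges :: "'a list \<Rightarrow> 'a set list" where
  "path_edges p = map2 (\<lambda>u v. {u, v}) p (tl p)"

definition path_between :: "'a set \<Rightarrow> 'a set set \<Rightarrow> 'a \<Rightarrow> 'a list \<Rightarrow> 'a \<Rightarrow> bool" where
  "path_between V E u p v \<longleftrightarrow>
     p \<noteq> [] \<and> hd p = u \<and> last p = v \<and> distinct p \<and> set p \<subseteq> V \<and> set (path_edges p) \<subseteq> E"

text \<open>The infimum of the empty set is \<open>\<infinity>\<close>, so distance and diameter are infinite
  in a disconnected graph.\<close>

definition graph_dist :: "'a set \<Rightarrow> 'a set set \<Rightarrow> 'a \<Rightarrow> 'a \<Rightarrow> enat" where
  "graph_dist V E u v = (INF p \<in> {p. path_between V E u p v}. enat (length (path_edges p)))"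

definition graph_diam :: "'a set \<Rightarrow> 'a set set \<Rightarrow> enat" where
  "graph_diam V E = (SUP u \<in> V. SUP v \<in> V. graph_dist V E u v)"

text \<open>On a path, \<open>j - i - 1\<close> edges lie between its edges number \<open>i < j\<close>.\<close>

definition distance2_proper :: "('a set \<Rightarrow> 'c) \<Rightarrow> 'a list \<Rightarrow> bool" where
  "distance2_proper c p \<longleftrightarrow>
     (\<forall>i j. i < j \<and> j < length (path_edges p) \<and> j - i - 1 < 2 \<longrightarrow>
        c (path_edges p ! i) \<noteq> c (path_edges p ! j))"

definition distance2_proper_connected :: "'a set \<Rightarrow> 'a set set \<Rightarrow> ('a set \<Rightarrow> 'c) \<Rightarrow> bool" where
  "distance2_proper_connected V E c \<longleftrightarrow>
     (\<forall>u\<in>V. \<forall>v\<in>V. u \<noteq> v \<longrightarrow> (\<exists>p. path_between V E u p v \<and> distance2_proper c p))"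

text \<open>Natural numbers serve as colors, which is no restriction for a finite graph. Only the colors
  of edges count. The value is \<open>\<infinity>\<close> if no coloring works, that is, if the graph is
  disconnected.\<close>

definition pc12 :: "'a set \<Rightarrow> 'a set set \<Rightarrow> enat" where
  "pc12 V E =
     (INF c \<in> {c :: 'a set \<Rightarrow> nat. distance2_proper_connected V E c}. enat (card (c ` E)))"

end

theory Submission
  imports Defs
begin

text \<open>Let \<open>x\<close> have eccentricity 3 in the complement \<open>H\<close>, with distance classes \<open>N1\<close>, \<open>N2\<close>, \<open>N3\<close>.
  In \<open>G\<close> the vertex \<open>x\<close> is joined to all of \<open>N2\<close> and \<open>N3\<close>, and \<open>N1\<close> is joined to all of \<open>N3\<close>.
  Give the edges between \<open>x\<close> and \<open>N3\<close> color 0, all other edges that meet \<open>N3\<close> color 1, and the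
  remaining edges color 2. Two vertices that are adjacent in \<open>H\<close> are joined in \<open>G\<close> by a
  path of one of the types
  \<open>x N3 N1\<close> (colors 01), \<open>N1 N3 x N2\<close> (102), \<open>N2 x N3\<close> (20), \<open>N3 x N2 N3\<close> (021) and
  \<open>N2 x N3 N1 N2\<close> (2012). For the last two types the end vertices \<open>u\<close>, \<open>v\<close> lie in the same class:
  the penultimate vertex is an \<open>H\<close>-neighbor of \<open>u\<close> in the preceding class, which is
  \<open>G\<close>-adjacent to \<open>v\<close> because \<open>H\<close> has no triangle.\<close>

section \<open>Edge sequences, reversal and short paths\<close>

lemma path_edges_simps [simp]:
  "path_edges [] = []"
  "path_edges [u] = []"
  "path_edges (u # v # p) = {u, v} # path_edges (v # p)"
  by (simp_all add: path_edges_def)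

definition distance2_joined :: "'a set \<Rightarrow> 'a set set \<Rightarrow> ('a set \<Rightarrow> 'c) \<Rightarrow> 'a \<Rightarrow> 'a \<Rightarrow> bool" where
  "distance2_joined V E c u v \<longleftrightarrow> (\<exists>p. path_between V E u p v \<and> distance2_proper c p)"

lemma path_edges_append_Cons:
  "path_edges (p @ [u, v]) = path_edges (p @ [u]) @ [{u, v}]"
proof (induction p)
  case (Cons a p)
  then show ?case by (cases p) auto
qed simp

lemma path_edges_rev: "path_edges (rev p) = rev (path_edges p)"
proof (induction p rule: induct_list012)
  case (3 u v p)
  then show ?case
    using path_edges_append_Cons[of "rev p" v u] by (simp add: insert_commute)
qed simp_all

text \<open>Reversing a path preserves the gaps between its edges. Hence each pair of distance
  classes needs treatment in one order only.\<close>

lemma distance2_joined_sym: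
  assumes "distance2_joined V E c u v"
  shows "distance2_joined V E c v u"
proof -
  obtain p where p: "path_between V E u p v" "distance2_proper c p"
    using assms by (auto simp: distance2_joined_def)
  have "path_between V E v (rev p) u"
    using p(1) by (auto simp: path_between_def path_edges_rev hd_rev last_rev)
  moreover have "distance2_proper c (rev p)"
    unfolding distance2_proper_def path_edges_rev
  proof (intro allI impI)
    fix i j
    let ?es = "path_edges p"
    let ?n = "length ?es"
    assume ij: "i < j \<and> j < length (rev ?es) \<and> j - i - 1 < 2"
    \<comment> \<open>Position \<open>i\<close> of the reversed list is position
      \<open>?n - Suc i\<close> of the original, so the order flips and the difference
      stays.\<close>
    then have "?n - Suc j < ?n - Suc i \<and> ?n - Suc i < ?n \<and> (?n - Suc i) - (?n - Suc j) - 1 < 2"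
      by auto
    then have "c (?es ! (?n - Suc j)) \<noteq> c (?es ! (?n - Suc i))"
      using p(2) unfolding distance2_proper_def by blast
    then show "c (rev ?es ! i) \<noteq> c (rev ?es ! j)"
      using ij by (simp add: rev_nth)
  qed
  ultimately show ?thesis by (auto simp: distance2_joined_def)
qed

text \<open>The condition only compares edges within a window of three consecutive ones; four edges
  are the most that the construction needs.\<close>

lemma distance2_proper_short:
  "distance2_proper c [u, v]"
  "c {u, v} \<noteq> c {v, w} \<Longrightarrow> distance2_proper c [u, v, w]"
  "distinct [c {u, v}, c {v, w}, c {w, y}] \<Longrightarrow> distance2_proper c [u, v, w, y]"
  "distinct [c {u, v}, c {v, w}, c {w, y}] \<Longrightarrow> distinct [c {v, w}, c {w, y}, c {y, z}] \<Longrightarrow>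
     distance2_proper c [u, v, w, y, z]"
  by (auto simp: distance2_proper_def less_Suc_eq)

section \<open>Distance and diameter as attained values\<close>

lemma graph_dist_le:
  assumes "path_between V E u p v"
  shows "graph_dist V E u v \<le> enat (length (path_edges p))"
  using assms by (auto simp: graph_dist_def intro: INF_lower)

text \<open>A finite value rules out the empty infimum, and a nonempty set in the well-order
  \<open>enat\<close> contains its infimum.\<close>

lemma graph_dist_attained:
  assumes "graph_dist V E u v \<noteq> \<infinity>"
  obtains p where "path_between V E u p v" "graph_dist V E u v = enat (length (path_edges p))"
proof -
  let ?L = "(\<lambda>p. enat (length (path_edges p))) ` {p. path_between V E u p v}"
  have "?L \<noteq> {}"
    using assms unfolding graph_dist_def by (metis Inf_empty top_enat_def)
  then have "Inf ?L \<in> ?L" by (metis (no_types, lifting) ex_in_conv wellorder_InfI)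
  then show thesis using that by (auto simp: graph_dist_def)
qed

lemma graph_diam_upper:
  assumes "u \<in> V" "v \<in> V"
  shows "graph_dist V E u v \<le> graph_diam V E"
  using assms unfolding graph_diam_def by (meson SUP_upper SUP_upper2)

text \<open>As \<open>n\<close> is not an upper bound, some distance exceeds \<open>n\<close>, and
  no value lies strictly between \<open>n\<close> and \<open>Suc n\<close>.\<close>

lemma graph_diam_attained:
  assumes "graph_diam V E = enat (Suc n)"
  obtains u v where "u \<in> V" "v \<in> V" "graph_dist V E u v = enat (Suc n)"
proof -
  have "\<not> graph_diam V E \<le> enat n"
    using assms by simp
  then obtain u v where uv: "u \<in> V" "v \<in> V" "enat n < graph_dist V E u v"
    unfolding graph_diam_def by (auto simp: SUP_le_iff not_le)
  moreover have "graph_dist V E u v \<le> enat (Suc n)"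
    using graph_diam_upper uv assms by metis
  ultimately have "graph_dist V E u v = enat (Suc n)"
    by (cases "graph_dist V E u v") auto
  then show thesis using that uv by blast
qed

lemma pc12_le:
  fixes c :: "'a set \<Rightarrow> nat"
  assumes "distance2_proper_connected V E c"
  shows "pc12 V E \<le> enat (card (c ` E))"
  using assms unfolding pc12_def by (auto intro: INF_lower)

text \<open>Collects all that the coloring argument needs to know about the classes, free of
  distances: where \<open>H\<close>, the adjacency of the complement, is absent, and where a
  neighbor in the preceding class exists.\<close>

locale distance_classes =
  fixes V :: "'a set" and E :: "'a set set" and x :: 'a and N1 N2 N3 :: "'a set"
  fixes H :: "'a \<Rightarrow> 'a \<Rightarrow> bool"
  assumes H_iff: "H u v \<longleftrightarrow> {u, v} \<in> complement_edges V E"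
    and triangle_free: "triangle_free (complement_edges V E)"
    and V_eq: "V = {x} \<union> N1 \<union> N2 \<union> N3"
    and disjoint: "x \<notin> N1" "x \<notin> N2" "x \<notin> N3" "N1 \<inter> N2 = {}" "N1 \<inter> N3 = {}" "N2 \<inter> N3 = {}"
    and N3_nonempty: "N3 \<noteq> {}"
    and no_H_edge: "v \<in> N2 \<union> N3 \<Longrightarrow> \<not> H x v" "u \<in> N1 \<Longrightarrow> v \<in> N3 \<Longrightarrow> \<not> H u v"
    and H_pred: "v \<in> N2 \<Longrightarrow> \<exists>u\<in>N1. H v u" "v \<in> N3 \<Longrightarrow> \<exists>u\<in>N2. H v u"
begin

definition col :: "'a set \<Rightarrow> nat" where
  "col e = (if e \<inter> N3 = {} then 2 else if x \<in> e then 0 else 1)"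

lemma G_edge:
  assumes "u \<in> V" "v \<in> V" "u \<noteq> v" "\<not> H u v"
  shows "{u, v} \<in> E"
  using assms by (auto simp: H_iff complement_edges_def)

lemma H_sym: "H u v \<longleftrightarrow> H v u"
  by (simp add: H_iff insert_commute)

lemma H_irrefl: "\<not> H u u"
  by (simp add: H_iff complement_edges_def)

text \<open>Shaped for its use: given \<open>H u v\<close>, a neighbor \<open>w\<close> of
  \<open>u\<close> in the preceding class cannot be an \<open>H\<close>-neighbor of
  \<open>v\<close>.\<close>

lemma no_H_triangle:
  assumes "H u v" "H u w"
  shows "\<not> H w v"
proof
  assume wv: "H w v"
  then have "u \<noteq> w" "w \<noteq> v" "u \<noteq> v"
    using assms H_irrefl by blast+
  then show False
    using triangle_free assms wv unfolding triangle_free_def H_iff by blast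
qed

lemma x_N2: "v \<in> N2 \<Longrightarrow> {x, v} \<in> E \<and> col {x, v} = 2"
  using disjoint by (auto intro!: G_edge simp: V_eq no_H_edge col_def)

lemma x_N3: "v \<in> N3 \<Longrightarrow> {x, v} \<in> E \<and> col {x, v} = 0"
  using disjoint by (auto intro!: G_edge simp: V_eq no_H_edge col_def)

lemma N1_N3: "u \<in> N1 \<Longrightarrow> v \<in> N3 \<Longrightarrow> {u, v} \<in> E \<and> col {u, v} = 1"
  using disjoint by (auto intro!: G_edge simp: V_eq no_H_edge col_def)

lemma N1_N2:
  assumes "u \<in> N1" "v \<in> N2" "\<not> H u v"
  shows "{u, v} \<in> E \<and> col {u, v} = 2"
  using assms disjoint by (auto intro!: G_edge simp: V_eq col_def)

lemma N2_N3:
  assumes "u \<in> N2" "v \<in> N3" "\<not> H u v"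
  shows "{u, v} \<in> E \<and> col {u, v} = 1"
  using assms disjoint by (auto intro!: G_edge simp: V_eq col_def)

section \<open>Paths between the classes\<close>

abbreviation joined :: "'a \<Rightarrow> 'a \<Rightarrow> bool" where
  "joined \<equiv> distance2_joined V E col"

lemma joinedI:
  assumes "distance2_proper col p" "p \<noteq> []" "hd p = u" "last p = v"
    "distinct p" "set p \<subseteq> V" "set (path_edges p) \<subseteq> E"
  shows "joined u v"
  using assms by (auto simp: distance2_joined_def path_between_def)

lemma joined_x_N1:
  assumes "v \<in> N1"
  shows "joined x v"
proof -
  obtain w where w: "w \<in> N3" using N3_nonempty by blast
  have "distinct [x, w, v]" "set [x, w, v] \<subseteq> V"
    using assms w disjoint unfolding V_eq by auto
  then show ?thesis
    using x_N3[OF w] N1_N3[OF assms w]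
    by (intro joinedI[of "[x, w, v]"] distance2_proper_short) (simp_all add: insert_commute)
qed

lemma joined_N1_N2:
  assumes "u \<in> N1" "v \<in> N2"
  shows "joined u v"
proof -
  obtain w where w: "w \<in> N3" using N3_nonempty by blast
  have "distinct [u, w, x, v]" "set [u, w, x, v] \<subseteq> V"
    using assms w disjoint unfolding V_eq by auto
  then show ?thesis
    using x_N3[OF w] N1_N3[OF assms(1) w] x_N2[OF assms(2)]
    by (intro joinedI[of "[u, w, x, v]"] distance2_proper_short) (simp_all add: insert_commute)
qed

lemma joined_N2_N3:
  assumes "u \<in> N2" "v \<in> N3"
  shows "joined u v"
proof -
  have "distinct [u, x, v]" "set [u, x, v] \<subseteq> V"
    using assms disjoint unfolding V_eq by auto
  then show ?thesis
    using x_N2[OF assms(1)] x_N3[OF assms(2)]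
    by (intro joinedI[of "[u, x, v]"] distance2_proper_short) (simp_all add: insert_commute)
qed

lemma joined_N3_N3:
  assumes "u \<in> N3" "v \<in> N3" "H u v"
  shows "joined u v"
proof -
  obtain p where p: "p \<in> N2" "H u p" using H_pred assms by blast
  have pv: "\<not> H p v" using no_H_triangle assms(3) p(2) .
  have "u \<noteq> v" using assms(3) H_irrefl by blast
  then have "distinct [u, x, p, v]" "set [u, x, p, v] \<subseteq> V"
    using assms p disjoint unfolding V_eq by auto
  then show ?thesis
    using x_N2[OF p(1)] x_N3[OF assms(1)] N2_N3[OF p(1) assms(2) pv]
    by (intro joinedI[of "[u, x, p, v]"] distance2_proper_short) (simp_all add: insert_commute)
qed

text \<open>The color 2 occurs on the first and the last of four edges, which is allowed since two
  edges lie in between.\<close>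

lemma joined_N2_N2:
  assumes "u \<in> N2" "v \<in> N2" "H u v"
  shows "joined u v"
proof -
  obtain w where w: "w \<in> N3" using N3_nonempty by blast
  obtain p where p: "p \<in> N1" "H u p" using H_pred assms by blast
  have pv: "\<not> H p v" using no_H_triangle assms(3) p(2) .
  have "u \<noteq> v" using assms(3) H_irrefl by blast
  then have "distinct [u, x, w, p, v]" "set [u, x, w, p, v] \<subseteq> V"
    using assms p w disjoint unfolding V_eq by auto
  then show ?thesis
    using x_N2[OF assms(1)] x_N3[OF w] N1_N3[OF p(1) w] N1_N2[OF p(1) assms(2) pv]
    by (intro joinedI[of "[u, x, w, p, v]"] distance2_proper_short) (simp_all add: insert_commute)
qed

text \<open>Such an edge would form a triangle with the common neighbor \<open>x\<close>.\<close>

lemma no_H_edge_N1: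
  assumes "u \<in> N1" "v \<in> N1" "\<forall>w\<in>N1. H x w"
  shows "\<not> H u v"
  using assms no_H_triangle by blast

lemma distance2_proper_connected_col:
  assumes "\<forall>w\<in>N1. H x w"
  shows "distance2_proper_connected V E col"
proof -
  have "joined u v" if uv: "u \<in> V" "v \<in> V" "u \<noteq> v" for u v
  proof (cases "H u v")
    case False
    then show ?thesis
      using uv G_edge by (intro joinedI[of "[u, v]"] distance2_proper_short) auto
  next
    case True
    \<comment> \<open>Up to symmetry this leaves the pairs \<open>x\<close>-\<open>N1\<close>,
      \<open>N1\<close>-\<open>N2\<close>, \<open>N2\<close>-\<open>N2\<close>,
      \<open>N2\<close>-\<open>N3\<close> and \<open>N3\<close>-\<open>N3\<close>.\<close>
    have H: "u \<notin> N1 \<or> v \<notin> N1" "u \<in> N1 \<Longrightarrow> v \<notin> N3" "v \<in> N1 \<Longrightarrow> u \<notin> N3"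
      "u = x \<Longrightarrow> v \<in> N1" "v = x \<Longrightarrow> u \<in> N1"
      using True uv no_H_edge no_H_edge_N1 assms H_sym unfolding V_eq by blast+
    show ?thesis
      using uv H True joined_x_N1 joined_N1_N2 joined_N2_N3 joined_N2_N2 joined_N3_N3
        distance2_joined_sym[of V E col] unfolding V_eq by blast
  qed
  then show ?thesis
    by (auto simp: distance2_proper_connected_def distance2_joined_def)
qed

lemma card_col_image: "card (col ` E) \<le> 3"
proof -
  have "col ` E \<subseteq> {0, 1, 2}" by (auto simp: col_def)
  then have "card (col ` E) \<le> card {0, 1, 2 :: nat}" by (intro card_mono) auto
  then show ?thesis by simp
qed

end

theorem theorem3p2:
  fixes V :: "'a set" and E :: "'a set set"
  assumes "simple_graph V E"
    and "triangle_free (complement_edges V E)"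
    and "graph_diam V (complement_edges V E) = 3"
  shows "pc12 V E \<le> 3"
proof -
  let ?F = "complement_edges V E"
  have diam: "graph_diam V ?F = enat (Suc 2)"
    using assms(3) by (simp add: numeral_eq_enat)
  obtain x y where xy: "x \<in> V" "y \<in> V" "graph_dist V ?F x y = enat (Suc 2)"
    using graph_diam_attained[OF diam] .
  define H where "H = (\<lambda>u v. {u, v} \<in> ?F)"
  have H_V: "u \<in> V" "v \<in> V" "u \<noteq> v" "H v u" if "H u v" for u v
    using that by (auto simp: H_def complement_edges_def insert_commute)
  define N1 where "N1 = {v. H x v}"
  define N2 where "N2 = {v. v \<noteq> x \<and> v \<notin> N1 \<and> (\<exists>u\<in>N1. H v u)}"
  \<comment> \<open>Taken as the remainder, so that the classes cover \<open>V\<close> by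
    definition; the diameter enters only in \<open>N3_pred\<close>.\<close>
  define N3 where "N3 = V - ({x} \<union> N1 \<union> N2)"
  have no_short: "\<not> path_between V ?F x p y" if "length (path_edges p) < 3" for p
    using graph_dist_le[of V ?F x p y] xy(3) that by auto
  have N3_nonempty: "y \<in> N3"
  proof -
    have "y \<noteq> x"
      using no_short[of "[x]"] xy by (auto simp: path_between_def)
    moreover have "y \<notin> N1"
      using no_short[of "[x, y]"] xy \<open>y \<noteq> x\<close> by (auto simp: path_between_def N1_def H_def)
    moreover have "y \<notin> N2"
    proof
      assume "y \<in> N2"
      then obtain u where "H x u" "H y u" by (auto simp: N2_def N1_def)
      then show False
        using no_short[of "[x, u, y]"] xy H_V[of x u] H_V[of y u] \<open>y \<noteq> x\<close>
        by (auto simp: path_between_def H_def insert_commute)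
    qed
    ultimately show ?thesis using xy by (simp add: N3_def)
  qed
  have N3_pred: "\<exists>u\<in>N2. H v u" if v: "v \<in> N3" for v
  proof -
    have "graph_dist V ?F x v \<le> enat 3"
      using graph_diam_upper[of x V v ?F] v xy(1) diam by (simp add: N3_def)
    then have "graph_dist V ?F x v \<noteq> \<infinity>"
      by (cases "graph_dist V ?F x v") simp_all
    then obtain p where p: "path_between V ?F x p v" "length (path_edges p) \<le> 3"
      using \<open>graph_dist V ?F x v \<le> enat 3\<close> by (metis graph_dist_attained enat_ord_simps(1))
    then have len: "length p \<le> 4" by (simp add: path_edges_def)
    then consider "p = []" | a where "p = [a]" | a b where "p = [a, b]"
      | a b d where "p = [a, b, d]" | a b d e where "p = [a, b, d, e]"
      by (auto simp: le_Suc_eq numeral_eq_Suc length_Suc_conv)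
    then show ?thesis
    proof cases
      \<comment> \<open>Here \<open>b\<close> is in \<open>N1\<close>. If \<open>d\<close> were in
        \<open>N1\<close> too, \<open>v\<close> would be in \<open>N2\<close>; so \<open>d\<close>
        is the required vertex of \<open>N2\<close>. Any shorter path would put \<open>v\<close>
        into \<open>{x}\<close>, \<open>N1\<close> or \<open>N2\<close>.\<close>
      case (5 a b d e)
      then have "H x b" "H b d" "H d v" "d \<noteq> x"
        using p(1) by (auto simp: path_between_def H_def)
      then show ?thesis
        using v H_V(4) by (auto simp: N1_def N2_def N3_def)
    qed (use p(1) v H_V(4) in \<open>auto simp: path_between_def N1_def N2_def N3_def H_def\<close>)
  qed
  interpret distance_classes V E x N1 N2 N3 H
  proof unfold_locales
    show "H u v \<longleftrightarrow> {u, v} \<in> ?F" for u v by (simp add: H_def)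
    show "triangle_free ?F" using assms(2) .
    show "V = {x} \<union> N1 \<union> N2 \<union> N3"
      using xy(1) H_V(1,2) unfolding N1_def N2_def N3_def by blast
    show "x \<notin> N1" using H_V(3) unfolding N1_def by blast
    show "N1 \<inter> N3 = {}" "N2 \<inter> N3 = {}" "x \<notin> N3" by (auto simp: N3_def)
    show "x \<notin> N2" "N1 \<inter> N2 = {}" by (auto simp: N2_def)
    show "N3 \<noteq> {}" using N3_nonempty by blast
    show "\<not> H x v" if "v \<in> N2 \<union> N3" for v
      using that by (auto simp: N1_def N2_def N3_def)
    \<comment> \<open>An \<open>H\<close>-neighbor of \<open>N1\<close> outside \<open>{x}\<close>
      and \<open>N1\<close> belongs to \<open>N2\<close>.\<close>
    show "\<not> H u v" if "u \<in> N1" "v \<in> N3" for u v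
      using that H_V(4) unfolding N2_def N3_def by blast
    show "\<exists>u\<in>N1. H v u" if "v \<in> N2" for v
      using that by (simp add: N2_def)
    show "\<exists>u\<in>N2. H v u" if "v \<in> N3" for v
      using N3_pred that .
  qed
  have "pc12 V E \<le> enat (card (col ` E))"
    by (intro pc12_le distance2_proper_connected_col) (simp add: N1_def)
  also have "\<dots> \<le> 3"
    using card_col_image by (simp add: numeral_eq_enat)
  finally show ?thesis .
qed

end
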